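(* The integrality gap of $\textsc{Dir-MC-Rel}$ for $st$-Bi-Cut is $2$, even restricted to planar directed graphs. Precisely: (i) for every directed graph $G$ with non-negative edge weights and terminals $s,t$, the minimum weight of an $st$-bi-cut is at most $2\cdot\mathrm{LP}(G)$; and (ii) for every $\varepsilon>0$ there exists a planar directed graph $G$ with non-negative edge weights and terminals $s,t$ such that $\mathrm{LP}(G)>0$ and the minimum weight of an $st$-bi-cut in $G$ is at least $(2-\varepsilon)\,\mathrm{LP}(G)$.
   Context: For a directed graph $G=(V,E)$ with non-negative weights $w_e$ and two distinct terminals $s,t$, an $st$-bi-cut is a set $E'\subseteq E$ such that $G-E'$ has no directed path from $s$ to $t$ and no directed path from $t$ to $s$; its weight is $\sum_{e\in E'}w_e$. $\mathrm{LP}(G)$ is the optimum value of the LP: minimize $\sum_e w_ex_e$ subject to $\sum_{e\in p}x_e\ge1$ for every directed $s$–$t$ path $p$ and every directed $t$–$s$ path $p$, and $x_e\ge0$ for all $e$. *)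

theory Defs
  imports "HOL-Analysis.Analysis"
begin

text \<open>A directed graph is given by a finite vertex set V and an arc set
E \<subseteq> V \<times> V (parallel arcs can be merged by adding their weights).
A directed path is a nonempty list of distinct vertices whose consecutive
pairs are arcs.\<close>

definition dpath :: "('a \<times> 'a) set \<Rightarrow> 'a list \<Rightarrow> bool" where
  "dpath E vs \<longleftrightarrow> vs \<noteq> [] \<and> distinct vs \<and> (\<forall>i. Suc i < length vs \<longrightarrow> (vs ! i, vs ! Suc i) \<in> E)"

definition path_arcs :: "'a list \<Rightarrow> ('a \<times> 'a) set" where
  "path_arcs vs = {(vs ! i, vs ! Suc i) | i. Suc i < length vs}"

definition dpath_from_to :: "('a \<times> 'a) set \<Rightarrow> 'a \<Rightarrow> 'a \<Rightarrow> 'a list \<Rightarrow> bool" where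
  "dpath_from_to E u v vs \<longleftrightarrow> dpath E vs \<and> hd vs = u \<and> last vs = v"

definition is_bicut :: "('a \<times> 'a) set \<Rightarrow> 'a \<Rightarrow> 'a \<Rightarrow> ('a \<times> 'a) set \<Rightarrow> bool" where
  "is_bicut E s t F \<longleftrightarrow> F \<subseteq> E \<and>
     \<not> (\<exists>p. dpath_from_to (E - F) s t p) \<and> \<not> (\<exists>p. dpath_from_to (E - F) t s p)"

definition min_bicut :: "('a \<times> 'a) set \<Rightarrow> ('a \<times> 'a \<Rightarrow> real) \<Rightarrow> 'a \<Rightarrow> 'a \<Rightarrow> real" where
  "min_bicut E w s t = Min {sum w F | F. is_bicut E s t F}"

definition lp_feasible :: "('a \<times> 'a) set \<Rightarrow> 'a \<Rightarrow> 'a \<Rightarrow> ('a \<times> 'a \<Rightarrow> real) \<Rightarrow> bool" where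
  "lp_feasible E s t x \<longleftrightarrow> (\<forall>e\<in>E. x e \<ge> 0) \<and>
     (\<forall>p. dpath_from_to E s t p \<longrightarrow> sum x (path_arcs p) \<ge> 1) \<and>
     (\<forall>p. dpath_from_to E t s p \<longrightarrow> sum x (path_arcs p) \<ge> 1)"

definition LP :: "('a \<times> 'a) set \<Rightarrow> ('a \<times> 'a \<Rightarrow> real) \<Rightarrow> 'a \<Rightarrow> 'a \<Rightarrow> real" where
  "LP E w s t = Inf {(\<Sum>e\<in>E. w e * x e) | x. lp_feasible E s t x}"

text \<open>Planarity: a drawing in the plane with vertices as distinct points and each
(non-loop) arc as a simple curve joining its endpoints, avoiding other vertices,
and two distinct arcs meeting only in common endpoints. Loops can always be drawn
and are irrelevant, so they are ignored.\<close>

definition planar :: "'a set \<Rightarrow> ('a \<times> 'a) set \<Rightarrow> bool" where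
  "planar V E \<longleftrightarrow> (\<exists>(f :: 'a \<Rightarrow> real^2) (\<gamma> :: 'a \<times> 'a \<Rightarrow> real \<Rightarrow> real^2).
     inj_on f V \<and>
     (\<forall>e\<in>E. fst e \<noteq> snd e \<longrightarrow>
        arc (\<gamma> e) \<and> pathstart (\<gamma> e) = f (fst e) \<and> pathfinish (\<gamma> e) = f (snd e) \<and>
        path_image (\<gamma> e) \<inter> f ` V = {f (fst e), f (snd e)}) \<and>
     (\<forall>e\<in>E. \<forall>e'\<in>E. fst e \<noteq> snd e \<longrightarrow> fst e' \<noteq> snd e' \<longrightarrow> e \<noteq> e' \<longrightarrow>
        path_image (\<gamma> e) \<inter> path_image (\<gamma> e') \<subseteq> f ` ({fst e, snd e} \<inter> {fst e', snd e'})))"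

end

theory Submission
  imports Defs "HOL-Library.Nat_Bijection"
begin

text \<open>
  Upper bound: let \<open>d\<close> be the distance from \<open>s\<close> with respect to a feasible \<open>x\<close>, truncated at 1.
  For a uniformly random threshold \<open>\<theta>\<close>, an arc \<open>(u, v)\<close> satisfies \<open>d u < \<theta> \<le> d v\<close> with probability
  at most \<open>x (u, v)\<close>, so some threshold cut separates \<open>s\<close> from \<open>t\<close> at cost at most the LP value.
  Doing the same from \<open>t\<close> and taking the union costs at most twice the LP value.

  Lower bound: on the vertices \<open>{0..n} \<times> {0..n}\<close> with \<open>s = (0, n)\<close> and \<open>t = (n, 0)\<close>, take diagonal
  arcs \<open>(i, j) \<rightarrow> (i + 1, j + 1)\<close> of weight 1 and arcs of weight \<open>2n\<close> decreasing one coordinate by 1.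
  An \<open>s\<close>-\<open>t\<close> path raises the first coordinate by \<open>n\<close>, a \<open>t\<close>-\<open>s\<close> path the second one, so \<open>x = 1/n\<close> on the
  diagonal arcs is feasible and the LP value is at most \<open>n\<close>. If a bi-cut contains no arc of weight \<open>2n\<close>,
  then the sets \<open>A\<close> and \<open>B\<close> reachable from \<open>s\<close> and from \<open>t\<close> are down-closed, and all diagonal arcs leaving
  \<open>A\<close> or \<open>B\<close> are cut. If \<open>A\<close> meets the rows 0 and \<open>n\<close> in \<open>{0..g\<^sub>0}\<close> and \<open>{0..g\<^sub>n}\<close>, then \<open>A\<close> is left
  along each diagonal \<open>i - j = d\<close> with \<open>g\<^sub>n - n < d \<le> g\<^sub>0\<close>, which gives \<open>n + g\<^sub>0 - g\<^sub>n\<close> arcs; likewise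
  \<open>n + h\<^sub>0 - h\<^sub>n\<close> arcs leave \<open>B\<close>. An arc leaving both lies on a diagonal with
  \<open>g\<^sub>n - h\<^sub>0 \<le> d \<le> g\<^sub>0 - h\<^sub>n\<close>, and there is at most one on each, so at least \<open>2n - 1\<close> arcs are cut.
\<close>

section \<open>Directed paths\<close>

lemma dpath_from_to_refl: "dpath_from_to E u u [u]"
  by (simp add: dpath_from_to_def dpath_def)

lemma path_arcs_singleton [simp]: "path_arcs [u] = {}"
  by (simp add: path_arcs_def)

lemma path_arcs_Cons_Cons: "path_arcs (u # v # vs) = insert (u, v) (path_arcs (v # vs))"
proof -
  have "{i. Suc i < length (u # v # vs)} = insert 0 (Suc ` {i. Suc i < length (v # vs)})"
    by (auto simp: image_iff) (metis Suc_less_eq gr0_conv_Suc not_gr_zero)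
  moreover have "path_arcs xs = (\<lambda>i. (xs ! i, xs ! Suc i)) ` {i. Suc i < length xs}" for xs :: "'a list"
    by (auto simp: path_arcs_def)
  ultimately show ?thesis by (simp add: image_image)
qed

lemma dpath_Cons_Cons:
  "dpath E (u # v # vs) \<longleftrightarrow> u \<notin> set (v # vs) \<and> (u, v) \<in> E \<and> dpath E (v # vs)"
proof -
  have "(\<forall>i. P i) \<longleftrightarrow> P 0 \<and> (\<forall>i. P (Suc i))" for P :: "nat \<Rightarrow> bool"
    by (metis not0_implies_Suc)
  from this[of "\<lambda>i. Suc i < length (u # v # vs) \<longrightarrow> ((u # v # vs) ! i, (u # v # vs) ! Suc i) \<in> E"]
  show ?thesis unfolding dpath_def by auto
qed

lemma path_arcs_subset: "dpath E vs \<Longrightarrow> path_arcs vs \<subseteq> E"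
  by (auto simp: dpath_def path_arcs_def)

lemma finite_path_arcs: "finite (path_arcs vs)"
proof -
  have "path_arcs vs = (\<lambda>i. (vs ! i, vs ! Suc i)) ` {i. Suc i < length vs}"
    by (auto simp: path_arcs_def)
  moreover have "finite {i. Suc i < length vs}"
    by (rule finite_subset[of _ "{..length vs}"]) auto
  ultimately show ?thesis by simp
qed

text \<open>Paths may not repeat vertices, so if \<open>v\<close> already lies on \<open>p\<close>,
  the path is cut off at \<open>v\<close> instead of being prolonged. For nonnegative lengths the
  inclusion of arc sets is enough to bound the new length.\<close>

lemma dpath_extend:
  assumes p: "dpath_from_to E s u p" and uv: "(u, v) \<in> E"
  obtains q where "dpath_from_to E s v q" "path_arcs q \<subseteq> insert (u, v) (path_arcs p)"
proof (cases "v \<in> set p")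
  case True
  then obtain ys zs where p_eq: "p = ys @ v # zs" by (meson split_list)
  let ?q = "ys @ [v]"
  have nth: "?q ! i = p ! i" if "i < length ?q" for i
    using that by (auto simp: p_eq nth_append)
  have "dpath_from_to E s v ?q"
    using p nth unfolding dpath_from_to_def dpath_def
    by (auto simp: p_eq hd_append split: if_splits)
  moreover have "path_arcs ?q \<subseteq> path_arcs p"
    unfolding path_arcs_def using nth by (fastforce simp: p_eq)
  ultimately show ?thesis using that by blast
next
  case False
  let ?q = "p @ [v]"
  have ne: "p \<noteq> []" and u: "p ! (length p - 1) = u"
    using p by (auto simp: dpath_from_to_def dpath_def last_conv_nth)
  have step: "(?q ! i, ?q ! Suc i) = (if Suc i < length p then (p ! i, p ! Suc i) else (u, v))"
    if "Suc i < length ?q" for i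
  proof (cases "Suc i < length p")
    case False
    with that have "i = length p - 1" using ne by auto
    then show ?thesis using ne u by (auto simp: nth_append)
  qed (auto simp: nth_append)
  have "dpath_from_to E s v ?q"
    using p uv step False ne unfolding dpath_from_to_def dpath_def
    by (auto split: if_splits)
  moreover have "path_arcs ?q \<subseteq> insert (u, v) (path_arcs p)"
    unfolding path_arcs_def using step by (force split: if_splits)
  ultimately show ?thesis using that by blast
qed

lemma rtrancl_imp_dpath:
  assumes "(s, v) \<in> E\<^sup>*"
  shows "\<exists>p. dpath_from_to E s v p"
  using assms
proof (induction rule: rtrancl_induct)
  case base
  show ?case by (rule exI, rule dpath_from_to_refl)
next
  case (step u v)
  then show ?case by (meson dpath_extend)
qed

text \<open>Potential differences telescope along the path. One such potential certifies the LP
  constraints of all paths between two terminals at once.\<close>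

lemma potential_le_path_sum:
  fixes \<phi> :: "'a \<Rightarrow> real"
  assumes "dpath E p" and "\<And>u v. (u, v) \<in> E \<Longrightarrow> \<phi> v - \<phi> u \<le> x (u, v)"
  shows "\<phi> (last p) - \<phi> (hd p) \<le> sum x (path_arcs p)"
  using assms(1)
proof (induction p rule: induct_list012)
  case (3 u v vs)
  then have IH: "\<phi> (last (v # vs)) - \<phi> v \<le> sum x (path_arcs (v # vs))"
    and uv: "(u, v) \<in> E" and u: "u \<notin> set (v # vs)"
    by (simp_all add: dpath_Cons_Cons)
  \<comment> \<open>\<open>path_arcs\<close> is a set, so the sum splits only because the first arc
    does not recur; distinctness of the vertices ensures this.\<close>
  have "(u, v) \<notin> path_arcs (v # vs)"
  proof
    assume "(u, v) \<in> path_arcs (v # vs)"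
    then obtain i where "u = (v # vs) ! i" "Suc i < length (v # vs)" by (auto simp: path_arcs_def)
    then show False using u by (metis Suc_lessD nth_mem)
  qed
  then have "sum x (path_arcs (u # v # vs)) = x (u, v) + sum x (path_arcs (v # vs))"
    by (simp add: path_arcs_Cons_Cons finite_path_arcs)
  with IH assms(2)[OF uv] show ?case by simp
qed (auto simp: dpath_def)

lemma dpath_ends_in_closed_set:
  assumes "dpath_from_to E s t p" "s \<in> S" "\<And>u v. (u, v) \<in> E \<Longrightarrow> u \<in> S \<Longrightarrow> v \<in> S"
  shows "t \<in> S"
proof -
  have "p ! i \<in> S" if "i < length p" for i
    using that
  proof (induction i)
    case 0
    then show ?case using assms(1,2) by (auto simp: dpath_from_to_def hd_conv_nth)
  next
    case (Suc i)
    then show ?case using assms(1,3) by (auto simp: dpath_from_to_def dpath_def)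
  qed
  then show ?thesis
    using assms(1) by (auto simp: dpath_from_to_def dpath_def last_conv_nth)
qed

section \<open>The upper bound\<close>

text \<open>Inserting 1 keeps the infimum meaningful at unreachable vertices and brings all
  distances into the range of the thresholds.\<close>

definition trunc_dist :: "('a \<times> 'a) set \<Rightarrow> ('a \<times> 'a \<Rightarrow> real) \<Rightarrow> 'a \<Rightarrow> 'a \<Rightarrow> real" where
  "trunc_dist E x s v = Inf (insert 1 {sum x (path_arcs p) | p. dpath_from_to E s v p})"

context
  fixes E :: "('a \<times> 'a) set" and x :: "'a \<times> 'a \<Rightarrow> real"
  assumes nonneg: "\<And>e. e \<in> E \<Longrightarrow> 0 \<le> x e"
begin

lemma path_sum_nonneg: "dpath_from_to E s v p \<Longrightarrow> 0 \<le> sum x (path_arcs p)"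
  by (rule sum_nonneg) (use path_arcs_subset nonneg in \<open>force simp: dpath_from_to_def\<close>)

lemma trunc_dist_bdd: "bdd_below (insert 1 {sum x (path_arcs p) | p. dpath_from_to E s v p})"
  using path_sum_nonneg by (intro bdd_belowI[of _ 0]) auto

lemma trunc_dist_nonneg: "0 \<le> trunc_dist E x s v"
  unfolding trunc_dist_def using path_sum_nonneg by (intro cInf_greatest) auto

lemma trunc_dist_le_one: "trunc_dist E x s v \<le> 1"
  unfolding trunc_dist_def by (rule cInf_lower[OF _ trunc_dist_bdd]) auto

lemma trunc_dist_le_path:
  "dpath_from_to E s v p \<Longrightarrow> trunc_dist E x s v \<le> sum x (path_arcs p)"
  unfolding trunc_dist_def by (rule cInf_lower[OF _ trunc_dist_bdd]) auto

lemma trunc_dist_self: "trunc_dist E x s s = 0"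
  using trunc_dist_le_path[OF dpath_from_to_refl, of s] trunc_dist_nonneg[of s s] by simp

lemma trunc_dist_eq_one:
  assumes "\<And>p. dpath_from_to E s t p \<Longrightarrow> 1 \<le> sum x (path_arcs p)"
  shows "trunc_dist E x s t = 1"
proof (rule antisym[OF trunc_dist_le_one])
  show "1 \<le> trunc_dist E x s t"
    unfolding trunc_dist_def using assms by (intro cInf_greatest) auto
qed

text \<open>Every path to \<open>u\<close> yields a path to \<open>v\<close> that is longer by at
  most \<open>x (u, v)\<close>; the inserted value 1 is handled by
  \<open>trunc_dist_le_one\<close>.\<close>

lemma trunc_dist_triangle:
  assumes uv: "(u, v) \<in> E"
  shows "trunc_dist E x s v \<le> trunc_dist E x s u + x (u, v)"
proof -
  have "trunc_dist E x s v - x (u, v) \<le> trunc_dist E x s u"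
    unfolding trunc_dist_def[of E x s u]
  proof (rule cInf_greatest)
    fix y assume "y \<in> insert 1 {sum x (path_arcs p) | p. dpath_from_to E s u p}"
    then consider "y = 1" | p where "y = sum x (path_arcs p)" "dpath_from_to E s u p" by blast
    then show "trunc_dist E x s v - x (u, v) \<le> y"
    proof cases
      case 1
      then show ?thesis using trunc_dist_le_one[of s v] nonneg[OF uv] by simp
    next
      case 2
      obtain q where q: "dpath_from_to E s v q" "path_arcs q \<subseteq> insert (u, v) (path_arcs p)"
        using dpath_extend[OF 2(2) uv] .
      have "path_arcs p \<subseteq> E"
        using 2(2) path_arcs_subset by (auto simp: dpath_from_to_def)
      then have "sum x (path_arcs q) \<le> sum x (insert (u, v) (path_arcs p))"
        using nonneg uv by (intro sum_mono2 q) (auto simp: finite_path_arcs)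
      also have "\<dots> \<le> x (u, v) + sum x (path_arcs p)"
        using nonneg[OF uv] by (simp add: sum.insert_if finite_path_arcs)
      finally show ?thesis using trunc_dist_le_path[OF q(1)] 2(1) by simp
    qed
  qed simp
  then show ?thesis by simp
qed

end

text \<open>Averaging: the weight of the threshold cut, integrated over [0, 1], equals the
  right-hand sum, so the smallest weight cannot exceed it.\<close>

lemma exists_threshold_below_average:
  fixes a b w :: "'e \<Rightarrow> real"
  assumes fin: "finite E"
    and ab: "\<And>e. e \<in> E \<Longrightarrow> 0 \<le> a e \<and> a e \<le> 1 \<and> 0 \<le> b e \<and> b e \<le> 1"
  obtains \<theta> where "0 < \<theta>" "\<theta> \<le> 1"
    "sum w {e\<in>E. a e < \<theta> \<and> \<theta> \<le> b e} \<le> (\<Sum>e\<in>E. w e * max 0 (b e - a e))"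
proof -
  define W where "W = (\<Sum>e\<in>E. w e * max 0 (b e - a e))"
  define c where "c \<theta> = sum w {e\<in>E. a e < \<theta> \<and> \<theta> \<le> b e}" for \<theta>
  have ind: "((\<lambda>\<theta>. if a e < \<theta> \<and> \<theta> \<le> b e then 1 else 0 :: real) has_integral max 0 (b e - a e)) {0..1}"
    if "e \<in> E" for e
  proof (cases "a e \<le> b e")
    case True
    have "((\<lambda>\<theta>. 1 :: real) has_integral (b e - a e)) {a e..b e}"
      using has_integral_const_real[of "1::real" "a e" "b e"] True by simp
    then have "((\<lambda>\<theta>. if \<theta> \<in> {a e..b e} then 1 else 0 :: real) has_integral (b e - a e)) {0..1}"
      using ab[OF that] by (subst has_integral_restrict) auto
    \<comment> \<open>The closed and the half-open interval differ only at
      \<open>a e\<close>.\<close>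
    then have "((\<lambda>\<theta>. if a e < \<theta> \<and> \<theta> \<le> b e then 1 else 0 :: real) has_integral (b e - a e)) {0..1}"
      by (rule has_integral_spike_finite[of "{a e}", rotated 2]) auto
    then show ?thesis using True by (simp add: max_def)
  next
    case False
    then have "(\<lambda>\<theta>. if a e < \<theta> \<and> \<theta> \<le> b e then 1 else 0 :: real) = (\<lambda>\<theta>. 0)" by auto
    then show ?thesis using False by (simp add: max_def)
  qed
  have c_sum: "c \<theta> = (\<Sum>e\<in>E. w e * (if a e < \<theta> \<and> \<theta> \<le> b e then 1 else 0))" for \<theta>
    unfolding c_def by (simp add: sum.inter_filter[OF fin] if_distrib cong: if_cong)
  have int: "(c has_integral W) {0..1}"
    unfolding c_sum W_def by (intro has_integral_sum has_integral_mult_right fin ind)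
  \<comment> \<open>Each value of \<open>c\<close> is the weight of one of finitely many arc sets,
    so the minimum is attained.\<close>
  have "c ` {0<..1} \<subseteq> sum w ` Pow E"
    unfolding c_def by auto
  then have fin_c: "finite (c ` {0<..1})"
    using fin by (meson finite_Pow_iff finite_imageI finite_subset)
  define m where "m = Min (c ` {0<..1})"
  have "m \<in> c ` {0<..1}"
    unfolding m_def using fin_c by (intro Min_in) auto
  then obtain \<theta> where \<theta>: "0 < \<theta>" "\<theta> \<le> 1" "m = c \<theta>" by auto
  \<comment> \<open>The open interval excludes 0, where \<open>m\<close> need not be a lower bound
    of \<open>c\<close>.\<close>
  have "((\<lambda>_. m) has_integral m) {0<..<1::real}"
    using has_integral_const_real[of m 0 "1::real"] by (simp add: has_integral_Icc_iff_Ioo)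
  moreover have "(c has_integral W) {0<..<1}"
    using int by (simp add: has_integral_Icc_iff_Ioo)
  ultimately have "m \<le> W"
    by (rule has_integral_le) (auto simp: m_def intro!: Min_le fin_c)
  then show ?thesis using that \<theta> by (simp add: c_def W_def)
qed

lemma exists_cut_le_fractional_cut:
  fixes E :: "('a \<times> 'a) set" and w x :: "'a \<times> 'a \<Rightarrow> real"
  assumes fin: "finite E" and w: "\<And>e. e \<in> E \<Longrightarrow> 0 \<le> w e" and x: "\<And>e. e \<in> E \<Longrightarrow> 0 \<le> x e"
    and sep: "\<And>p. dpath_from_to E s t p \<Longrightarrow> 1 \<le> sum x (path_arcs p)"
  obtains F where "F \<subseteq> E" "\<And>p. \<not> dpath_from_to (E - F) s t p" "sum w F \<le> (\<Sum>e\<in>E. w e * x e)"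
proof -
  define d where "d = trunc_dist E x s"
  obtain \<theta> where \<theta>: "0 < \<theta>" "\<theta> \<le> 1"
    and le: "sum w {e\<in>E. d (fst e) < \<theta> \<and> \<theta> \<le> d (snd e)}
      \<le> (\<Sum>e\<in>E. w e * max 0 (d (snd e) - d (fst e)))"
    by (rule exists_threshold_below_average[of E "\<lambda>e. d (fst e)" "\<lambda>e. d (snd e)" w])
      (use trunc_dist_nonneg[of E x s] trunc_dist_le_one[of E x s] fin x in \<open>auto simp: d_def\<close>)
  let ?F = "{e\<in>E. d (fst e) < \<theta> \<and> \<theta> \<le> d (snd e)}"
  have "(\<Sum>e\<in>E. w e * max 0 (d (snd e) - d (fst e))) \<le> (\<Sum>e\<in>E. w e * x e)"
  proof (intro sum_mono mult_left_mono w)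
    fix e assume "e \<in> E"
    then show "max 0 (d (snd e) - d (fst e)) \<le> x e"
      using trunc_dist_triangle[of E x "fst e" "snd e" s] x by (simp add: d_def)
  qed
  moreover have "\<not> dpath_from_to (E - ?F) s t p" for p
  proof
    assume "dpath_from_to (E - ?F) s t p"
    \<comment> \<open>No surviving arc leaves this set. It contains \<open>s\<close>, as
      \<open>d s = 0 < \<theta>\<close>, but not \<open>t\<close>, as
      \<open>d t = 1 \<ge> \<theta>\<close>.\<close>
    then have "t \<in> {v. d v < \<theta>}"
    proof (rule dpath_ends_in_closed_set)
      show "s \<in> {v. d v < \<theta>}" using trunc_dist_self[of E x s] x \<theta> by (simp add: d_def)
    qed auto
    then show False using trunc_dist_eq_one[of E x s t] x sep \<theta> by (simp add: d_def)
  qed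
  ultimately show ?thesis using that[of ?F] le by fastforce
qed

section \<open>Bi-cuts as unions of two one-way cuts\<close>

lemma finite_bicut_weights: "finite E \<Longrightarrow> finite {sum w F | F. is_bicut E s t F}"
  by (rule finite_subset[of _ "sum w ` Pow E"]) (auto simp: is_bicut_def)

lemma path_arcs_nonempty:
  assumes "dpath_from_to E s t p" "s \<noteq> t"
  shows "path_arcs p \<noteq> {}"
proof -
  obtain u v vs where "p = u # v # vs"
    using assms by (cases p; cases "tl p") (auto simp: dpath_from_to_def dpath_def)
  then show ?thesis by (simp add: path_arcs_Cons_Cons)
qed

text \<open>Guarantees that \<open>min_bicut\<close> takes its \<open>Min\<close> over a nonempty
  set.\<close>

lemma bicut_all: "s \<noteq> t \<Longrightarrow> is_bicut E s t E"
  using path_arcs_nonempty path_arcs_subset unfolding is_bicut_def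
  by (metis Diff_cancel dpath_from_to_def order_refl subset_empty)

lemma min_bicut_le:
  assumes "finite E" "is_bicut E s t F"
  shows "min_bicut E w s t \<le> sum w F"
  unfolding min_bicut_def using assms by (intro Min_le finite_bicut_weights) auto

lemma lp_feasible_one: "s \<noteq> t \<Longrightarrow> lp_feasible E s t (\<lambda>_. 1)"
  unfolding lp_feasible_def using path_arcs_nonempty finite_path_arcs
  by (force simp: Suc_le_eq card_gt_0_iff)

lemma min_bicut_le_twice_LP:
  fixes E :: "('a \<times> 'a) set" and w :: "'a \<times> 'a \<Rightarrow> real"
  assumes fin: "finite E" and st: "s \<noteq> t" and w: "\<And>e. e \<in> E \<Longrightarrow> 0 \<le> w e"
  shows "min_bicut E w s t \<le> 2 * LP E w s t"
proof -
  \<comment> \<open>In this form the bound can be checked against each feasible value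
    separately.\<close>
  have "min_bicut E w s t / 2 \<le> LP E w s t"
    unfolding LP_def
  proof (rule cInf_greatest)
    show "{(\<Sum>e\<in>E. w e * x e) | x. lp_feasible E s t x} \<noteq> {}"
      using lp_feasible_one[OF st] by auto
    fix y assume "y \<in> {(\<Sum>e\<in>E. w e * x e) | x. lp_feasible E s t x}"
    then obtain x where y: "y = (\<Sum>e\<in>E. w e * x e)" and x: "lp_feasible E s t x" by blast
    obtain F where F: "F \<subseteq> E" "\<And>p. \<not> dpath_from_to (E - F) s t p" "sum w F \<le> y"
      using exists_cut_le_fractional_cut[of E w x s t] fin w x y unfolding lp_feasible_def by metis
    obtain G where G: "G \<subseteq> E" "\<And>p. \<not> dpath_from_to (E - G) t s p" "sum w G \<le> y"
      using exists_cut_le_fractional_cut[of E w x t s] fin w x y unfolding lp_feasible_def by metis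
    have mono: "dpath_from_to D u v p" if "dpath_from_to C u v p" "C \<subseteq> D" for C D u v p
      using that by (auto simp: dpath_from_to_def dpath_def)
    have "is_bicut E s t (F \<union> G)"
      using F G mono[of "E - (F \<union> G)" _ _ _ "E - F"] mono[of "E - (F \<union> G)" _ _ _ "E - G"]
      unfolding is_bicut_def by blast
    then have "min_bicut E w s t \<le> sum w (F \<union> G)" by (rule min_bicut_le[OF fin])
    also have "\<dots> \<le> sum w F + sum w G"
    proof -
      have "0 \<le> sum w (F \<inter> G)" using F G w by (intro sum_nonneg) auto
      moreover have "sum w (F \<union> G) + sum w (F \<inter> G) = sum w F + sum w G"
        using F G fin by (intro sum.union_inter) (auto intro: finite_subset)
      ultimately show ?thesis by simp
    qed
    finally show "min_bicut E w s t / 2 \<le> y" using F G by simp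
  qed
  then show ?thesis by simp
qed

section \<open>Boundaries of down-sets in a square grid\<close>

text \<open>A diagonal arc leaving \<open>A\<close> is represented by its tail.\<close>

definition diag_boundary :: "nat \<Rightarrow> (nat \<times> nat) set \<Rightarrow> (nat \<times> nat) set" where
  "diag_boundary n A = {(i, j). i < n \<and> j < n \<and> (i, j) \<in> A \<and> (Suc i, Suc j) \<notin> A}"

lemma finite_diag_boundary: "finite (diag_boundary n A)"
  by (rule finite_subset[of _ "{..n} \<times> {..n}"]) (auto simp: diag_boundary_def)

definition down_closed :: "(nat \<times> nat) set \<Rightarrow> bool" where
  "down_closed A \<longleftrightarrow> (\<forall>i j i' j'. (i, j) \<in> A \<longrightarrow> i' \<le> i \<longrightarrow> j' \<le> j \<longrightarrow> (i', j') \<in> A)"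

lemma down_closedD: "down_closed A \<Longrightarrow> (i, j) \<in> A \<Longrightarrow> i' \<le> i \<Longrightarrow> j' \<le> j \<Longrightarrow> (i', j') \<in> A"
  unfolding down_closed_def by blast

lemma last_true_before:
  fixes P :: "nat \<Rightarrow> bool"
  assumes "P 0" "\<not> P m"
  obtains k where "k < m" "P k" "\<not> P (Suc k)"
proof -
  obtain k where "k < m" "\<forall>i\<le>k. P i" "\<not> P (Suc k)"
    using ex_least_nat_less[of "\<lambda>i. \<not> P i" m] assms by auto
  then show ?thesis using that by auto
qed

lemma down_closed_row:
  assumes "down_closed A" "(0, j) \<in> A" "(n, j) \<notin> A"
  obtains g where "g < n" "\<And>i. (i, j) \<in> A \<longleftrightarrow> i \<le> g"
proof -
  obtain g where g: "g < n" "(g, j) \<in> A" "(Suc g, j) \<notin> A"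
    using last_true_before[of "\<lambda>i. (i, j) \<in> A"] assms(2,3) by blast
  then have "(i, j) \<in> A \<longleftrightarrow> i \<le> g" for i
    using down_closedD[OF assms(1)] by (metis not_less_eq_eq order_refl)
  then show ?thesis using that g by blast
qed

lemma card_diag_boundary_ge:
  assumes dc: "down_closed A" and top: "\<And>j. j \<le> n \<Longrightarrow> (n, j) \<notin> A"
    and g0: "g0 < n" "\<And>i. (i, 0) \<in> A \<longleftrightarrow> i \<le> g0"
    and gn: "gn < n" "\<And>i. (i, n) \<in> A \<longleftrightarrow> i \<le> gn"
  shows "n + g0 \<le> card (diag_boundary n A) + gn"
proof -
  let ?diag = "\<lambda>(i, j). int i - int j"
  have "{int gn - int n<..int g0} \<subseteq> ?diag ` diag_boundary n A"
  proof
    fix d assume d: "d \<in> {int gn - int n<..int g0}"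
    show "d \<in> ?diag ` diag_boundary n A"
    proof (cases "0 \<le> d")
      \<comment> \<open>This diagonal starts at \<open>(e, 0)\<close>, in \<open>A\<close> since
        \<open>e \<le> g0\<close>, and ends at \<open>(n, n - e)\<close>, outside by
        \<open>top\<close>; somewhere in between it leaves \<open>A\<close>.\<close>
      case True
      define e where "e = nat d"
      have e: "e \<le> g0" "e < n" "d = int e" using d True g0(1) by (auto simp: e_def)
      obtain k where "k < n - e" "(e + k, k) \<in> A" "(e + Suc k, Suc k) \<notin> A"
        using last_true_before[of "\<lambda>k. (e + k, k) \<in> A" "n - e"] g0(2)[of e] top[of "n - e"] e by auto
      then have "(e + k, k) \<in> diag_boundary n A" by (auto simp: diag_boundary_def)
      then show ?thesis using e by (force simp: image_iff)
    next
      \<comment> \<open>This diagonal starts at \<open>(0, e)\<close>, in \<open>A\<close> by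
        down-closure from \<open>(0, n)\<close>, and ends at \<open>(n - e, n)\<close>, outside
        since \<open>gn < n - e\<close>.\<close>
      case False
      define e where "e = nat (- d)"
      have e: "gn < n - e" "e < n" "d = - int e" using d False by (auto simp: e_def)
      have "(0, e) \<in> A" using gn(2)[of 0] down_closedD[OF dc, of 0 n 0 e] e by auto
      then obtain k where "k < n - e" "(k, e + k) \<in> A" "(Suc k, e + Suc k) \<notin> A"
        using last_true_before[of "\<lambda>k. (k, e + k) \<in> A" "n - e"] gn(2)[of "n - e"] e by auto
      then have "(k, e + k) \<in> diag_boundary n A" by (auto simp: diag_boundary_def)
      then show ?thesis using e by (force simp: image_iff)
    qed
  qed
  then have "card {int gn - int n<..int g0} \<le> card (diag_boundary n A)"
    by (meson card_image_le card_mono finite_diag_boundary finite_imageI order_trans)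
  then show ?thesis by simp
qed

lemma card_diag_boundary_Un_ge:
  assumes A: "down_closed A" "(0, n) \<in> A" "(n, 0) \<notin> A"
    and B: "down_closed B" "(n, 0) \<in> B" "(0, n) \<notin> B"
  shows "2 * n \<le> card (diag_boundary n A \<union> diag_boundary n B) + 1"
proof -
  have A_top: "(n, j) \<notin> A" for j using A(3) down_closedD[OF A(1), of n j n 0] by auto
  have B_top: "(j, n) \<notin> B" for j using B(3) down_closedD[OF B(1), of j n 0 n] by auto
  \<comment> \<open>Swapping coordinates puts \<open>B\<close> in the same position as
    \<open>A\<close>, so the row lemmas apply; \<open>h0\<close> and \<open>hn\<close> describe the
    columns 0 and \<open>n\<close> of \<open>B\<close>.\<close>
  define B' where "B' = prod.swap ` B"
  have B'_iff: "(i, j) \<in> B' \<longleftrightarrow> (j, i) \<in> B" for i j by (force simp: B'_def)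
  have B'_dc: "down_closed B'" using B(1) unfolding down_closed_def B'_iff by blast
  have in_A: "(0, j) \<in> A" if "j \<le> n" for j using A(2) down_closedD[OF A(1)] that by blast
  have in_B: "(0, j) \<in> B'" if "j \<le> n" for j using B(2) down_closedD[OF B(1)] that B'_iff by blast
  have B'_top: "(n, j) \<notin> B'" for j using B_top B'_iff by blast
  obtain g0 where g0: "g0 < n" "\<And>i. (i, 0) \<in> A \<longleftrightarrow> i \<le> g0"
    using down_closed_row[OF A(1) in_A A_top, of 0] by auto
  obtain gn where gn: "gn < n" "\<And>i. (i, n) \<in> A \<longleftrightarrow> i \<le> gn"
    using down_closed_row[OF A(1) in_A A_top, of n] by auto
  obtain h0 where h0: "h0 < n" "\<And>i. (i, 0) \<in> B' \<longleftrightarrow> i \<le> h0"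
    using down_closed_row[OF B'_dc in_B B'_top, of 0] by auto
  obtain hn where hn: "hn < n" "\<And>i. (i, n) \<in> B' \<longleftrightarrow> i \<le> hn"
    using down_closed_row[OF B'_dc in_B B'_top, of n] by auto
  have cA: "n + g0 \<le> card (diag_boundary n A) + gn"
    by (rule card_diag_boundary_ge[OF A(1) A_top g0 gn])
  have "diag_boundary n B' = prod.swap ` diag_boundary n B"
    by (force simp: diag_boundary_def B'_iff)
  then have "card (diag_boundary n B') = card (diag_boundary n B)"
    by (simp add: card_image)
  then have cB: "n + h0 \<le> card (diag_boundary n B) + hn"
    using card_diag_boundary_ge[OF B'_dc B'_top h0 hn] by simp
  let ?diag = "\<lambda>(i, j). int i - int j"
  let ?I = "diag_boundary n A \<inter> diag_boundary n B"
  \<comment> \<open>If the later of two vertices on a diagonal is in \<open>A\<close>, down-closure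
    puts the diagonal successor of the earlier one in \<open>A\<close>, so no arc leaves
    there.\<close>
  have lt: False if "(i, j) \<in> ?I" "(i', j') \<in> ?I" "int i - int j = int i' - int j'" "i < i'" for i j i' j'
    using that down_closedD[OF A(1), of i' j' "Suc i" "Suc j"] by (auto simp: diag_boundary_def)
  have "inj_on ?diag ?I"
  proof (rule inj_onI, clarify)
    fix i j i' j' assume *: "(i, j) \<in> diag_boundary n A" "(i, j) \<in> diag_boundary n B"
      "(i', j') \<in> diag_boundary n A" "(i', j') \<in> diag_boundary n B" "int i - int j = int i' - int j'"
    then have "\<not> i < i'" "\<not> i' < i" using lt[of i j i' j'] lt[of i' j' i j] by auto
    then show "i = i' \<and> j = j'" using * by auto
  qed
  \<comment> \<open>Projecting the tail, which lies in both sets, to the axes gives the upper bounds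
    on \<open>i\<close> and \<open>j\<close>; pushing the head, which lies in neither, to the far
    sides gives the lower bounds.\<close>
  moreover have "?diag ` ?I \<subseteq> {int gn - int h0..int g0 - int hn}"
  proof clarify
    fix i j assume *: "(i, j) \<in> diag_boundary n A" "(i, j) \<in> diag_boundary n B"
    have "i \<le> g0" using * g0(2) down_closedD[OF A(1), of i j i 0] by (auto simp: diag_boundary_def)
    moreover have "j \<le> h0"
      using * h0(2) B'_iff down_closedD[OF B(1), of i j 0 j] by (auto simp: diag_boundary_def)
    moreover have "gn \<le> i"
      using * gn(2)[of "Suc i"] down_closedD[OF A(1), of "Suc i" n "Suc i" "Suc j"]
      by (auto simp: diag_boundary_def)
    moreover have "hn \<le> j"
      using * hn(2)[of "Suc j"] B'_iff down_closedD[OF B(1), of n "Suc j" "Suc i" "Suc j"]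
      by (auto simp: diag_boundary_def)
    ultimately show "int i - int j \<in> {int gn - int h0..int g0 - int hn}" by simp
  qed
  ultimately have "card ?I \<le> card {int gn - int h0..int g0 - int hn}"
    by (metis card_image card_mono finite_atLeastAtMost_int)
  \<comment> \<open>These inequalities make the natural subtractions below exact. The terms
    \<open>g0 - gn\<close> and \<open>h0 - hn\<close> then cancel in inclusion-exclusion, leaving
    \<open>2 * n - 1\<close>.\<close>
  moreover have "gn \<le> g0" using gn(2)[of gn] g0(2)[of gn] down_closedD[OF A(1), of gn n gn 0] by auto
  moreover have "hn \<le> h0" using hn(2)[of hn] h0(2)[of hn] down_closedD[OF B'_dc, of hn n hn 0] by auto
  ultimately have "card ?I \<le> (g0 - gn) + (h0 - hn) + 1" by simp
  moreover have "card (diag_boundary n A) + card (diag_boundary n B)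
      = card (diag_boundary n A \<union> diag_boundary n B) + card ?I"
    by (rule card_Un_Int) (auto simp: finite_diag_boundary)
  ultimately show ?thesis using cA cB \<open>gn \<le> g0\<close> \<open>hn \<le> h0\<close> by linarith
qed


section \<open>The gap instance\<close>

definition diag_arcs :: "nat \<Rightarrow> ((nat \<times> nat) \<times> (nat \<times> nat)) set" where
  "diag_arcs n = {((i, j), (Suc i, Suc j)) | i j. i < n \<and> j < n}"

definition back_arcs :: "nat \<Rightarrow> ((nat \<times> nat) \<times> (nat \<times> nat)) set" where
  "back_arcs n = {((Suc i, j), (i, j)) | i j. i < n \<and> j \<le> n}
    \<union> {((i, Suc j), (i, j)) | i j. i \<le> n \<and> j < n}"

text \<open>Grid vertices are coded as numbers because the theorem asks for a graph on
  \<open>nat\<close>.\<close>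

abbreviation enc_arc :: "(nat \<times> nat) \<times> (nat \<times> nat) \<Rightarrow> nat \<times> nat" where
  "enc_arc \<equiv> map_prod prod_encode prod_encode"

definition grid_V :: "nat \<Rightarrow> nat set" where
  "grid_V n = prod_encode ` ({..n} \<times> {..n})"

definition grid_E :: "nat \<Rightarrow> (nat \<times> nat) set" where
  "grid_E n = enc_arc ` (diag_arcs n \<union> back_arcs n)"

text \<open>The weight \<open>2 * real n\<close> makes a single back arc exceed the bound
  \<open>2 * real n - 1\<close> by itself.\<close>

definition grid_w :: "nat \<Rightarrow> nat \<times> nat \<Rightarrow> real" where
  "grid_w n e = (if e \<in> enc_arc ` diag_arcs n then 1 else 2 * real n)"

lemma inj_enc_arc: "inj enc_arc"
  by (simp add: prod.inj_map inj_prod_encode)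

lemma finite_grid_V: "finite (grid_V n)"
  by (simp add: grid_V_def)

lemma grid_E_subset: "grid_E n \<subseteq> grid_V n \<times> grid_V n"
  by (auto simp: grid_E_def grid_V_def diag_arcs_def back_arcs_def)

lemma finite_grid_E: "finite (grid_E n)"
  by (rule finite_subset[OF grid_E_subset]) (simp add: finite_grid_V)

lemma back_arc_notin_diag: "e \<in> back_arcs n \<Longrightarrow> enc_arc e \<notin> enc_arc ` diag_arcs n"
  by (subst inj_image_mem_iff[OF inj_enc_arc]) (auto simp: diag_arcs_def back_arcs_def)

lemma card_diag_arcs: "card (diag_arcs n) = n * n"
proof -
  have "diag_arcs n = (\<lambda>(i, j). ((i, j), (Suc i, Suc j))) ` ({..<n} \<times> {..<n})"
    by (auto simp: diag_arcs_def)
  moreover have "inj_on (\<lambda>(i, j). ((i, j), (Suc i, Suc j))) ({..<n} \<times> {..<n})"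
    by (auto simp: inj_on_def)
  ultimately show ?thesis by (simp add: card_image card_cartesian_product)
qed

section \<open>A fractional solution on the grid\<close>

lemma LP_le:
  assumes "lp_feasible E s t x" and w: "\<And>e. e \<in> E \<Longrightarrow> 0 \<le> w e"
  shows "LP E w s t \<le> (\<Sum>e\<in>E. w e * x e)"
  unfolding LP_def
proof (rule cInf_lower)
  show "bdd_below {(\<Sum>e\<in>E. w e * x e) | x. lp_feasible E s t x}"
    using w by (intro bdd_belowI[of _ 0]) (auto simp: lp_feasible_def intro!: sum_nonneg)
qed (use assms in blast)

lemma grid_LP_le:
  assumes "0 < n"
  shows "LP (grid_E n) (grid_w n) (prod_encode (0, n)) (prod_encode (n, 0)) \<le> real n"
proof -
  define x :: "nat \<times> nat \<Rightarrow> real" where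
    "x e = (if e \<in> enc_arc ` diag_arcs n then 1 / real n else 0)" for e
  have x_diag: "x (enc_arc e) = 1 / real n" if "e \<in> diag_arcs n" for e
    using that by (simp add: x_def)
  have x_back: "x (enc_arc e) = 0" if "e \<in> back_arcs n" for e
    using back_arc_notin_diag[OF that] by (simp add: x_def)
  \<comment> \<open>The scaled coordinates serve as potentials: a diagonal arc raises both by
    \<open>1 / real n\<close> and a back arc raises neither. From \<open>s\<close> to
    \<open>t\<close> the first rises by 1, from \<open>t\<close> to \<open>s\<close> the
    second.\<close>
  define \<phi> where "\<phi> k = real (fst (prod_decode k)) / real n" for k
  define \<psi> where "\<psi> k = real (snd (prod_decode k)) / real n" for k
  have \<phi>: "\<phi> v - \<phi> u \<le> x (u, v)" and \<psi>: "\<psi> v - \<psi> u \<le> x (u, v)" if "(u, v) \<in> grid_E n" for u v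
  proof -
    from that obtain e where e: "(u, v) = enc_arc e" "e \<in> diag_arcs n \<or> e \<in> back_arcs n"
      by (auto simp: grid_E_def)
    show "\<phi> v - \<phi> u \<le> x (u, v)" "\<psi> v - \<psi> u \<le> x (u, v)"
      using e x_diag[of e] x_back[of e] assms
      by (auto simp: diag_arcs_def back_arcs_def \<phi>_def \<psi>_def field_simps)
  qed
  have "lp_feasible (grid_E n) (prod_encode (0, n)) (prod_encode (n, 0)) x"
    unfolding lp_feasible_def
  proof (intro conjI ballI allI impI)
    show "0 \<le> x e" for e by (simp add: x_def)
    show "1 \<le> sum x (path_arcs p)"
      if "dpath_from_to (grid_E n) (prod_encode (0, n)) (prod_encode (n, 0)) p" for p
      using potential_le_path_sum[of "grid_E n" p \<phi> x] \<phi> that assms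
      by (auto simp: dpath_from_to_def \<phi>_def)
    show "1 \<le> sum x (path_arcs p)"
      if "dpath_from_to (grid_E n) (prod_encode (n, 0)) (prod_encode (0, n)) p" for p
      using potential_le_path_sum[of "grid_E n" p \<psi> x] \<psi> that assms
      by (auto simp: dpath_from_to_def \<psi>_def)
  qed
  then have "LP (grid_E n) (grid_w n) (prod_encode (0, n)) (prod_encode (n, 0))
      \<le> (\<Sum>e\<in>grid_E n. grid_w n e * x e)"
    by (rule LP_le) (simp add: grid_w_def)
  also have "\<dots> = (\<Sum>e\<in>enc_arc ` diag_arcs n. 1 / real n)"
    by (rule sum.mono_neutral_cong_right) (use finite_grid_E[of n] in \<open>auto simp: grid_E_def x_def grid_w_def\<close>)
  also have "\<dots> = real n"
    using assms by (simp add: card_image inj_on_subset[OF inj_enc_arc] card_diag_arcs)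
  finally show ?thesis .
qed

section \<open>Bi-cuts of the grid\<close>

lemma grid_reach_down_closed:
  assumes "F \<inter> enc_arc ` back_arcs n = {}"
  shows "down_closed {(i, j). i \<le> n \<and> j \<le> n \<and> (s, prod_encode (i, j)) \<in> (grid_E n - F)\<^sup>*}"
    (is "down_closed ?A")
proof -
  have uncut: "(prod_encode p, prod_encode q) \<in> grid_E n - F" if "(p, q) \<in> back_arcs n" for p q
  proof -
    have "enc_arc (p, q) \<in> grid_E n" "enc_arc (p, q) \<in> enc_arc ` back_arcs n"
      using that unfolding grid_E_def by blast+
    then show ?thesis using assms by auto
  qed
  \<comment> \<open>Uncut back arcs lead from each reached vertex one step left and one step
    down.\<close>
  have left: "(i, j) \<in> ?A" if "(Suc i, j) \<in> ?A" for i j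
    using that uncut[of "(Suc i, j)" "(i, j)"] by (auto simp: back_arcs_def intro: rtrancl_into_rtrancl)
  have down: "(i, j) \<in> ?A" if "(i, Suc j) \<in> ?A" for i j
    using that uncut[of "(i, Suc j)" "(i, j)"] by (auto simp: back_arcs_def intro: rtrancl_into_rtrancl)
  show ?thesis
    unfolding down_closed_def
  proof (intro allI impI)
    fix i j i' j' assume "(i, j) \<in> ?A" "i' \<le> i" "j' \<le> j"
    have "(i', j) \<in> ?A"
      by (rule inc_induct[OF \<open>i' \<le> i\<close>, of "\<lambda>k. (k, j) \<in> ?A"]) (fact, rule left)
    then show "(i', j') \<in> ?A"
      by (rule inc_induct[OF \<open>j' \<le> j\<close>, of "\<lambda>k. (i', k) \<in> ?A"]) (rule down)
  qed
qed

lemma grid_reach_boundary_cut: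
  assumes "(i, j) \<in> diag_boundary n {(i, j). i \<le> n \<and> j \<le> n \<and> (s, prod_encode (i, j)) \<in> (grid_E n - F)\<^sup>*}"
  shows "enc_arc ((i, j), (Suc i, Suc j)) \<in> F"
proof (rule ccontr)
  assume "enc_arc ((i, j), (Suc i, Suc j)) \<notin> F"
  moreover have "enc_arc ((i, j), (Suc i, Suc j)) \<in> grid_E n"
    unfolding grid_E_def using assms by (intro imageI) (auto simp: diag_boundary_def diag_arcs_def)
  ultimately have "(prod_encode (i, j), prod_encode (Suc i, Suc j)) \<in> grid_E n - F" by simp
  then show False using assms by (auto simp: diag_boundary_def intro: rtrancl_into_rtrancl)
qed

lemma grid_bicut_ge:
  assumes "0 < n" and F: "is_bicut (grid_E n) (prod_encode (0, n)) (prod_encode (n, 0)) F"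
  shows "2 * real n - 1 \<le> sum (grid_w n) F"
proof (cases "F \<inter> enc_arc ` back_arcs n = {}")
  case False
  then obtain e where e: "e \<in> F" "e \<in> enc_arc ` back_arcs n" by blast
  have "finite F" using F finite_subset[OF _ finite_grid_E] by (auto simp: is_bicut_def)
  then have "grid_w n e \<le> sum (grid_w n) F"
    using e(1) by (intro member_le_sum) (auto simp: grid_w_def)
  moreover have "grid_w n e = 2 * real n"
    using e(2) back_arc_notin_diag by (metis (no_types) grid_w_def imageE)
  ultimately show ?thesis by simp
next
  case True
  define R where "R s = {(i, j). i \<le> n \<and> j \<le> n \<and> (s, prod_encode (i, j)) \<in> (grid_E n - F)\<^sup>*}" for s
  let ?s = "prod_encode (0, n)" and ?t = "prod_encode (n, 0)"
  let ?D = "diag_boundary n (R ?s) \<union> diag_boundary n (R ?t)"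
  let ?arc = "\<lambda>(i, j). enc_arc ((i, j), (Suc i, Suc j))"
  have dc: "down_closed (R s)" for s
    unfolding R_def by (rule grid_reach_down_closed[OF True])
  have "2 * n \<le> card ?D + 1"
  proof (rule card_diag_boundary_Un_ge[OF dc _ _ dc])
    show "(0, n) \<in> R ?s" "(n, 0) \<in> R ?t" by (auto simp: R_def)
    \<comment> \<open>A reached opposite terminal would give a simple path surviving the
      bi-cut.\<close>
    show "(n, 0) \<notin> R ?s" "(0, n) \<notin> R ?t"
      using F rtrancl_imp_dpath unfolding R_def is_bicut_def by fast+
  qed
  moreover have sub: "?arc ` ?D \<subseteq> F"
    using grid_reach_boundary_cut[of _ _ n _ F] unfolding R_def by auto
  moreover have fin: "finite F" using F finite_subset[OF _ finite_grid_E] by (auto simp: is_bicut_def)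
  moreover have "inj_on ?arc ?D" by (auto simp: inj_on_def)
  ultimately have "2 * n \<le> card F + 1"
    by (metis (no_types, lifting) add_le_mono1 card_image card_mono order_trans)
  \<comment> \<open>Every arc weighs at least 1, so counting arcs bounds the weight.\<close>
  moreover have "real (card F) \<le> sum (grid_w n) F"
    using sum_mono[of F "\<lambda>_. 1" "grid_w n"] assms(1) by (simp add: grid_w_def)
  ultimately show ?thesis by linarith
qed

lemma grid_min_bicut_ge:
  assumes "0 < n"
  shows "2 * real n - 1 \<le> min_bicut (grid_E n) (grid_w n) (prod_encode (0, n)) (prod_encode (n, 0))"
proof -
  let ?S = "{sum (grid_w n) F | F. is_bicut (grid_E n) (prod_encode (0, n)) (prod_encode (n, 0)) F}"
  have "prod_encode (0, n) \<noteq> prod_encode (n, 0)" using assms by simp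
  then have "?S \<noteq> {}" using bicut_all[of _ _ "grid_E n"] by blast
  then have "Min ?S \<in> ?S" by (intro Min_in finite_bicut_weights finite_grid_E)
  then show ?thesis unfolding min_bicut_def using grid_bicut_ge[OF assms] by auto
qed

subsection \<open>Planarity\<close>

definition grid_point :: "nat \<Rightarrow> real^2" where
  "grid_point k = vector [real (fst (prod_decode k)), real (snd (prod_decode k))]"

lemma grid_point_nth [simp]:
  "grid_point (prod_encode (i, j)) $ 1 = real i" "grid_point (prod_encode (i, j)) $ 2 = real j"
  by (simp_all add: grid_point_def)

lemma inj_grid_point: "inj grid_point"
proof (rule injI)
  fix k l assume "grid_point k = grid_point l"
  then have "grid_point k $ 1 = grid_point l $ 1" "grid_point k $ 2 = grid_point l $ 2" by simp_all
  then have "prod_decode k = prod_decode l" by (simp add: grid_point_def prod_eq_iff)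
  then show "k = l" by (metis prod_decode_inverse)
qed

text \<open>A common description of all arcs by lower left end \<open>(i, j)\<close> and step
  \<open>(a, b)\<close>: diagonal arcs point away from \<open>(i, j)\<close>, back arcs towards
  it.\<close>

definition grid_arc :: "nat \<Rightarrow> nat \<Rightarrow> nat \<Rightarrow> nat \<Rightarrow> nat \<times> nat" where
  "grid_arc i j a b =
    (if a = 1 \<and> b = 1 then enc_arc ((i, j), (i + a, j + b)) else enc_arc ((i + a, j + b), (i, j)))"

lemma grid_arc_cases:
  assumes "e \<in> grid_E n"
  obtains i j a b where "e = grid_arc i j a b" "(a, b) \<in> {(1, 0), (0, 1), (1, 1)}"
proof -
  from assms obtain i j where "e = grid_arc i j 1 1 \<or> e = grid_arc i j 1 0 \<or> e = grid_arc i j 0 1"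
    by (auto simp: grid_E_def diag_arcs_def back_arcs_def grid_arc_def)
  then show ?thesis using that by fastforce
qed

lemma grid_arc_ends: "{fst (grid_arc i j a b), snd (grid_arc i j a b)} = {prod_encode (i, j), prod_encode (i + a, j + b)}"
  by (auto simp: grid_arc_def)

definition grid_curve :: "nat \<times> nat \<Rightarrow> real \<Rightarrow> real^2" where
  "grid_curve e = linepath (grid_point (fst e)) (grid_point (snd e))"

lemma grid_curve_image:
  assumes q: "q \<in> path_image (grid_curve (grid_arc i j a b))"
  obtains \<tau> where "0 \<le> \<tau>" "\<tau> \<le> 1" "q $ 1 = real i + \<tau> * real a" "q $ 2 = real j + \<tau> * real b"
proof -
  have "q \<in> closed_segment (grid_point (prod_encode (i, j))) (grid_point (prod_encode (i + a, j + b)))"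
    using q by (auto simp: grid_curve_def grid_arc_def closed_segment_commute split: if_splits)
  then obtain \<tau> where \<tau>: "0 \<le> \<tau>" "\<tau> \<le> 1"
    and q_eq: "q = (1 - \<tau>) *\<^sub>R grid_point (prod_encode (i, j)) + \<tau> *\<^sub>R grid_point (prod_encode (i + a, j + b))"
    by (auto simp: in_segment)
  have "q $ 1 = real i + \<tau> * real a" "q $ 2 = real j + \<tau> * real b"
    unfolding q_eq by (simp_all add: algebra_simps)
  with \<tau> show ?thesis by (rule that)
qed

text \<open>A point of an edge that is not one of its ends determines the edge: the integer parts of its
  coordinates give the lower left corner, and the coordinates that are not integral give the
  direction.\<close>

lemma grid_curve_point:
  assumes ab: "(a, b) \<in> {(1, 0), (0, 1), (1, 1)}"
    and q: "q \<in> path_image (grid_curve (grid_arc i j a b))"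
  shows "q \<in> grid_point ` {fst (grid_arc i j a b), snd (grid_arc i j a b)} \<or>
    (q $ 1 \<notin> \<int> \<or> q $ 2 \<notin> \<int>) \<and>
    i = nat \<lfloor>q $ 1\<rfloor> \<and> j = nat \<lfloor>q $ 2\<rfloor> \<and> a = of_bool (q $ 1 \<notin> \<int>) \<and> b = of_bool (q $ 2 \<notin> \<int>)"
proof -
  obtain \<tau> where \<tau>: "0 \<le> \<tau>" "\<tau> \<le> 1" "q $ 1 = real i + \<tau> * real a" "q $ 2 = real j + \<tau> * real b"
    using grid_curve_image[OF q] .
  consider "\<tau> = 0" | "\<tau> = 1" | "0 < \<tau>" "\<tau> < 1" using \<tau> by linarith
  then show ?thesis
  proof cases
    case 1
    then have "q = grid_point (prod_encode (i, j))" using \<tau> by (simp add: vec_eq_iff forall_2)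
    then show ?thesis unfolding grid_arc_ends by simp
  next
    case 2
    then have "q = grid_point (prod_encode (i + a, j + b))" using \<tau> by (simp add: vec_eq_iff forall_2)
    then show ?thesis unfolding grid_arc_ends by simp
  next
    case 3
    have floor: "\<lfloor>real k + \<tau>\<rfloor> = int k" for k using 3 by (intro floor_unique) auto
    have "real k + \<tau> \<notin> \<int>" for k
      using 3 floor[of k] by (auto elim!: Ints_cases)
    then show ?thesis using ab \<tau>(3,4) floor by auto
  qed
qed

lemma grid_point_Ints: "grid_point k $ 1 \<in> \<int>" "grid_point k $ 2 \<in> \<int>"
  by (simp_all add: grid_point_def)

lemma planar_grid: "planar (grid_V n) (grid_E n)"
  unfolding planar_def
proof (intro exI[of _ grid_point] exI[of _ grid_curve] conjI ballI impI)
  show "inj_on grid_point (grid_V n)" using inj_grid_point inj_on_subset by blast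
next
  fix e assume e: "e \<in> grid_E n" "fst e \<noteq> snd e"
  then have ne: "grid_point (fst e) \<noteq> grid_point (snd e)" by (simp add: inj_eq[OF inj_grid_point])
  show "arc (grid_curve e)" unfolding grid_curve_def by (rule arc_linepath[OF ne])
  show "pathstart (grid_curve e) = grid_point (fst e)" "pathfinish (grid_curve e) = grid_point (snd e)"
    by (simp_all add: grid_curve_def)
  show "path_image (grid_curve e) \<inter> grid_point ` grid_V n = {grid_point (fst e), grid_point (snd e)}"
  proof
    show "path_image (grid_curve e) \<inter> grid_point ` grid_V n \<subseteq> {grid_point (fst e), grid_point (snd e)}"
    proof
      fix q assume q: "q \<in> path_image (grid_curve e) \<inter> grid_point ` grid_V n"
      obtain i j a b where "e = grid_arc i j a b" "(a, b) \<in> {(1, 0), (0, 1), (1, 1)}"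
        using grid_arc_cases[OF e(1)] .
      \<comment> \<open>Grid points have integral coordinates, so only the first alternative of
        \<open>grid_curve_point\<close> remains.\<close>
      then show "q \<in> {grid_point (fst e), grid_point (snd e)}"
        using grid_curve_point[of a b q i j] q grid_point_Ints by auto
    qed
    show "{grid_point (fst e), grid_point (snd e)} \<subseteq> path_image (grid_curve e) \<inter> grid_point ` grid_V n"
      using e(1) grid_E_subset[of n] by (auto simp: grid_curve_def)
  qed
next
  fix e e' assume e: "e \<in> grid_E n" and e': "e' \<in> grid_E n" and ne: "e \<noteq> e'"
  obtain i j a b where ij: "e = grid_arc i j a b" "(a, b) \<in> {(1, 0), (0, 1), (1, 1)}"
    using grid_arc_cases[OF e] .
  obtain i' j' a' b' where ij': "e' = grid_arc i' j' a' b'" "(a', b') \<in> {(1, 0), (0, 1), (1, 1)}"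
    using grid_arc_cases[OF e'] .
  show "path_image (grid_curve e) \<inter> path_image (grid_curve e')
      \<subseteq> grid_point ` ({fst e, snd e} \<inter> {fst e', snd e'})"
  proof
    fix q assume "q \<in> path_image (grid_curve e) \<inter> path_image (grid_curve e')"
    \<comment> \<open>A common point interior to both arcs would force \<open>e = e'\<close>; one
      interior to just one arc would be both integral and not.\<close>
    then have "q \<in> grid_point ` {fst e, snd e} \<and> q \<in> grid_point ` {fst e', snd e'}"
      using grid_curve_point[OF ij(2), of q i j] grid_curve_point[OF ij'(2), of q i' j']
        ij(1) ij'(1) ne grid_point_Ints by (metis IntE imageE)
    then show "q \<in> grid_point ` ({fst e, snd e} \<inter> {fst e', snd e'})"
      by (simp only: image_Int[OF inj_grid_point] Int_iff)
  qed
qed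

section \<open>Combination of the two bounds\<close>

theorem mainTheorem6:
  shows "(\<forall>(V :: 'a set) E (w :: 'a \<times> 'a \<Rightarrow> real) s t.
            finite V \<longrightarrow> E \<subseteq> V \<times> V \<longrightarrow> s \<in> V \<longrightarrow> t \<in> V \<longrightarrow> s \<noteq> t \<longrightarrow>
            (\<forall>e\<in>E. w e \<ge> 0) \<longrightarrow>
            min_bicut E w s t \<le> 2 * LP E w s t)
       \<and> (\<forall>\<epsilon>>0. \<exists>(V :: nat set) E (w :: nat \<times> nat \<Rightarrow> real) s t.
            finite V \<and> E \<subseteq> V \<times> V \<and> s \<in> V \<and> t \<in> V \<and> s \<noteq> t \<and>
            (\<forall>e\<in>E. w e \<ge> 0) \<and> planar V E \<and>
            LP E w s t > 0 \<and> min_bicut E w s t \<ge> (2 - \<epsilon>) * LP E w s t)"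
proof (intro conjI allI impI)
  fix V :: "'a set" and E and w :: "'a \<times> 'a \<Rightarrow> real" and s t :: 'a
  assume "finite V" "E \<subseteq> V \<times> V" "s \<noteq> t" "\<forall>e\<in>E. w e \<ge> 0"
  then show "min_bicut E w s t \<le> 2 * LP E w s t"
    by (intro min_bicut_le_twice_LP) (auto intro: finite_subset)
next
  fix \<epsilon> :: real assume "\<epsilon> > 0"
  \<comment> \<open>The grid has ratio at least \<open>(2 * real n - 1) / real n\<close>, which is
    \<open>2 - 1 / real n\<close>.\<close>
  then obtain n where "0 < n" and n: "1 / real n < \<epsilon>"
    using nat_approx_posE by (metis zero_less_Suc)
  let ?s = "prod_encode (0, n)" and ?t = "prod_encode (n, 0)"
  let ?L = "LP (grid_E n) (grid_w n) ?s ?t" and ?M = "min_bicut (grid_E n) (grid_w n) ?s ?t"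
  have st: "?s \<noteq> ?t" "?s \<in> grid_V n" "?t \<in> grid_V n" using \<open>0 < n\<close> by (auto simp: grid_V_def)
  have w: "0 \<le> grid_w n e" for e by (simp add: grid_w_def)
  have M: "2 * real n - 1 \<le> ?M" by (rule grid_min_bicut_ge[OF \<open>0 < n\<close>])
  \<comment> \<open>The upper bound, applied to the grid itself, turns the lower bound on bi-cuts
    into positivity of the LP value.\<close>
  also have "?M \<le> 2 * ?L" by (rule min_bicut_le_twice_LP[OF finite_grid_E st(1) w])
  finally have L: "0 < ?L" using \<open>0 < n\<close> by linarith
  have "(2 - \<epsilon>) * ?L \<le> (2 - 1 / real n) * ?L"
    using n L by (intro mult_right_mono) auto
  also have "\<dots> \<le> (2 - 1 / real n) * real n"
    using grid_LP_le[OF \<open>0 < n\<close>] \<open>0 < n\<close> by (intro mult_left_mono) (auto simp: field_simps)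
  also have "\<dots> = 2 * real n - 1" using \<open>0 < n\<close> by (simp add: field_simps)
  finally have "(2 - \<epsilon>) * ?L \<le> ?M" using M by linarith
  then show "\<exists>(V :: nat set) E (w :: nat \<times> nat \<Rightarrow> real) s t.
      finite V \<and> E \<subseteq> V \<times> V \<and> s \<in> V \<and> t \<in> V \<and> s \<noteq> t \<and>
      (\<forall>e\<in>E. w e \<ge> 0) \<and> planar V E \<and>
      LP E w s t > 0 \<and> min_bicut E w s t \<ge> (2 - \<epsilon>) * LP E w s t"
    using finite_grid_V grid_E_subset planar_grid st w L
    by (intro exI[of _ "grid_V n"] exI[of _ "grid_E n"] exI[of _ "grid_w n"] exI[of _ ?s] exI[of _ ?t]) simp
qed

end
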